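(* Let $k\ge 0$ be an integer, $r=k+1$, $\nu>0$, $0<T<\infty$, $M$ a positive integer and $\tau=T/M$. Let $I_h$ be a partition of $I=(0,1)$ and let $g_h\in S_h^0$. Then there exist $U_n\in S_h^0$, $n=1,2,\dots,M$, satisfying, with $U_0=g_h$ and $\bar\partial_tU_n=(U_n-U_{n-1})/\tau$, $$(\bar\partial_tU_n^0,v^0)_h+\nu(d_{w,r}U_n,d_{w,r}v)_h+\tfrac13(U_n^0\,d_{w,r}U_n,v^0)_h-\tfrac13(U_n^0U_n^0,d_{w,r}v)_h=0,\quad\forall v\in S_h^0,\ n=1,\dots,M.$$
   Context: Partition: $I_h:\ 0=x_1<x_2<\dots<x_N=1$, $I_i=(x_i,x_{i+1})$. $P_m(I_i)$ denotes polynomials of degree at most $m$ on $I_i$. Weak functions: $S_h$ is the space of $v$ consisting of an interior part $v^0$ with $v^0|_{I_i}\in P_k(I_i)$ for each $i=1,\dots,N-1$ (no continuity between elements required), together with one real nodal value $v^i$ at each node $x_i$, $i=1,\dots,N$ (not necessarily related to traces of $v^0$). $S_h^0=\{v\in S_h: v^1=v^N=0\}$. $U_n^0$ denotes the interior part of $U_n$. Discrete weak derivative: for $v\in S_h$, $d_{w,r}v$ is the piecewise polynomial with $d_{w,r}v|_{I_i}\in P_r(I_i)$ determined on each element by $\int_{I_i}(d_{w,r}v)\,q\,dx=-\int_{I_i}v^0q'\,dx+v^{i+1}q(x_{i+1})-v^iq(x_i)$ for all $q\in P_r(I_i)$. Discrete inner product: $(u,v)_h=\sum_{i=1}^{N-1}\int_{I_i}uv\,dx$.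 *)

theory Defs
  imports "HOL-Analysis.Analysis" "HOL-Computational_Algebra.Polynomial"
begin

definition is_partition :: "nat \<Rightarrow> (nat \<Rightarrow> real) \<Rightarrow> bool" where
  "is_partition N x \<longleftrightarrow>
     2 \<le> N \<and> x 1 = 0 \<and> x N = 1 \<and> (\<forall>i\<in>{1..<N}. x i < x (Suc i))"

text \<open>A piecewise polynomial \<open>p\<close> is a family of polynomials: \<open>p i\<close> is its restriction to the
  element between \<open>x i\<close> and \<open>x (i + 1)\<close>, for \<open>1 \<le> i < N\<close>. Nothing relates different elements,
  so no continuity is imposed.\<close>

record weak_function =
  interior_part :: "nat \<Rightarrow> real poly"
  nodal_value :: "nat \<Rightarrow> real"

text \<open>Indices that belong to no element or no node carry the value 0, so that a weak function is
  determined by its polynomials and nodal values.\<close>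

definition weak_space :: "nat \<Rightarrow> nat \<Rightarrow> weak_function set" where
  "weak_space N k = {v.
     (\<forall>i\<in>{1..<N}. degree (interior_part v i) \<le> k) \<and>
     (\<forall>i. i \<notin> {1..<N} \<longrightarrow> interior_part v i = 0) \<and>
     (\<forall>i. i \<notin> {1..N} \<longrightarrow> nodal_value v i = 0)}"

definition weak_space0 :: "nat \<Rightarrow> nat \<Rightarrow> weak_function set" where
  "weak_space0 N k = {v \<in> weak_space N k. nodal_value v 1 = 0 \<and> nodal_value v N = 0}"

definition is_weak_deriv_on ::
  "nat \<Rightarrow> (nat \<Rightarrow> real) \<Rightarrow> weak_function \<Rightarrow> nat \<Rightarrow> real poly \<Rightarrow> bool" where
  "is_weak_deriv_on r x v i p \<longleftrightarrow> degree p \<le> r \<and>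
     (\<forall>q. degree q \<le> r \<longrightarrow>
        integral {x i..x (Suc i)} (\<lambda>t. poly p t * poly q t) =
          - integral {x i..x (Suc i)} (\<lambda>t. poly (interior_part v i) t * poly (pderiv q) t)
          + nodal_value v (Suc i) * poly q (x (Suc i)) - nodal_value v i * poly q (x i))"

text \<open>The description below is proper on every nondegenerate element, see
  \<open>is_weak_deriv_on_weak_deriv\<close>.\<close>

definition weak_deriv ::
  "nat \<Rightarrow> (nat \<Rightarrow> real) \<Rightarrow> weak_function \<Rightarrow> nat \<Rightarrow> real poly" where
  "weak_deriv r x v i = (THE p. is_weak_deriv_on r x v i p)"

definition inner_h ::
  "nat \<Rightarrow> (nat \<Rightarrow> real) \<Rightarrow> (nat \<Rightarrow> real poly) \<Rightarrow> (nat \<Rightarrow> real poly) \<Rightarrow> real" where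
  "inner_h N x p q =
     (\<Sum>i=1..N-1. integral {x i..x (Suc i)} (\<lambda>t. poly (p i) t * poly (q i) t))"

definition diff_quot :: "real \<Rightarrow> weak_function \<Rightarrow> weak_function \<Rightarrow> weak_function" where
  "diff_quot \<tau> u w =
     \<lparr>interior_part = (\<lambda>i. smult (1 / \<tau>) (interior_part u i - interior_part w i)),
      nodal_value = (\<lambda>i. (nodal_value u i - nodal_value w i) / \<tau>)\<rparr>"

lemma poly_mult_integrable: "(\<lambda>t. poly p t * poly q t) integrable_on {a..b::real}"
  by (intro integrable_continuous_real continuous_intros)

lemma integral_square_pos:
  fixes d :: "real poly"
  assumes "a < b" "d \<noteq> 0"
  shows "integral {a..b} (\<lambda>t. poly d t * poly d t) > 0"
proof -
  let ?f = "\<lambda>t. poly d t * poly d t"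
  have ge: "integral {a..b} ?f \<ge> 0"
    by (intro integral_nonneg poly_mult_integrable) auto
  have "integral {a..b} ?f \<noteq> 0"
  proof
    assume z: "integral {a..b} ?f = 0"
    have "continuous_on {a..b} ?f" by (intro continuous_intros)
    with z assms(1) have "\<And>t. t \<in> {a..b} \<Longrightarrow> ?f t = 0"
      using integral_eq_0_iff[of a b ?f] by auto
    hence "{a..b} \<subseteq> {t. poly d t = 0}" by auto
    moreover have "infinite {a..b}" using assms(1) by (simp add: infinite_Icc)
    ultimately show False using poly_roots_finite[OF assms(2)] finite_subset by blast
  qed
  with ge show ?thesis by linarith
qed

lemma poly_riesz_ex:
  fixes L :: "real poly \<Rightarrow> real"
  assumes ab: "a < b"
    and add: "\<And>p q. L (p + q) = L p + L q" and scale: "\<And>c p. L (smult c p) = c * L p"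
  shows "\<exists>p. degree p \<le> r \<and> (\<forall>q. degree q \<le> r \<longrightarrow>
           integral {a..b} (\<lambda>t. poly p t * poly q t) = L q)"
  using add scale
proof (induction r arbitrary: L)
  case 0
  let ?c = "L 1 / (b - a)"
  have "integral {a..b} (\<lambda>t. poly [:?c:] t * poly q t) = L q" if q: "degree q \<le> 0" for q
  proof -
    obtain e where e: "q = [:e:]" using q degree_eq_zeroE by auto
    have "L q = e * L 1" using 0(2)[of e 1] e by (simp add: smult_one)
    thus ?thesis using ab e by simp
  qed
  thus ?case by (intro exI[of _ "[:?c:]"]) simp
next
  case (Suc r)
  let ?I = "\<lambda>p q. integral {a..b} (\<lambda>t. poly p t * poly q t)"
  have Iadd: "?I p (q + q') = ?I p q + ?I p q'" for p q q' :: "real poly"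
    by (simp add: distrib_left integral_add poly_mult_integrable)
  have Iscale: "?I p (smult c q) = c * ?I p q" for p q :: "real poly" and c
    by (simp add: mult.left_commute[of _ c])
  have Icomm: "?I p q = ?I q p" for p q :: "real poly"
    by (simp add: mult.commute)
  let ?m = "monom (1::real) (Suc r)"
  obtain p1 where p1: "degree p1 \<le> r" "\<And>q. degree q \<le> r \<Longrightarrow> ?I p1 q = ?I ?m q"
    using Suc.IH[of "?I ?m"] Iadd Iscale by blast
  obtain p0 where p0: "degree p0 \<le> r" "\<And>q. degree q \<le> r \<Longrightarrow> ?I p0 q = L q"
    using Suc.IH[of L] Suc.prems by blast
  define e where "e = ?m + smult (-1) p1"
  have cf: "coeff e (Suc r) = 1" using p1(1) by (simp add: e_def coeff_eq_0)
  have de: "degree e \<le> Suc r" unfolding e_def using p1(1)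
    by (intro degree_add_le) (auto simp: degree_monom_eq)
  have e0: "e \<noteq> 0" using cf by auto
  have orth: "?I e q = 0" if "degree q \<le> r" for q
    using p1(2)[OF that] Iadd[of q ?m "smult (-1) p1"] Iscale[of q "-1" p1]
      Icomm[of q e] Icomm[of q ?m] Icomm[of q p1] by (simp add: e_def)
  have pos: "?I e e > 0" using integral_square_pos[OF ab e0] .
  define c where "c = (L e - ?I p0 e) / ?I e e"
  define p where "p = p0 + smult c e"
  have Ip: "?I p q = ?I p0 q + c * ?I e q" for q
    using Iadd[of q p0 "smult c e"] Iscale[of q c e]
      Icomm[of q p] Icomm[of q p0] Icomm[of q e] by (simp add: p_def)
  have "?I p q = L q" if q: "degree q \<le> Suc r" for q
  proof -
    define d where "d = coeff q (Suc r)"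
    define q1 where "q1 = q + smult (- d) e"
    have dq1: "degree q1 \<le> r"
    proof (rule degree_le, intro allI impI)
      fix i assume "r < i"
      show "coeff q1 i = 0"
      proof (cases "i = Suc r")
        case True thus ?thesis by (simp add: q1_def d_def cf)
      next
        case False
        with \<open>r < i\<close> have "Suc r < i" by simp
        thus ?thesis using q de by (simp add: q1_def coeff_eq_0)
      qed
    qed
    have qq: "q = q1 + smult d e" by (simp add: q1_def)
    have a: "?I p q1 = L q1" using Ip[of q1] orth[OF dq1] p0(2)[OF dq1] by simp
    have b: "?I p e = L e" using Ip[of e] pos by (simp add: c_def)
    show ?thesis unfolding qq using Iadd[of p q1 "smult d e"] Iscale[of p d e] a b Suc.prems by simp
  qed
  moreover have "degree p \<le> Suc r" unfolding p_def using p0(1) de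
    by (intro degree_add_le) auto
  ultimately show ?case by blast
qed

lemma is_weak_deriv_on_unique:
  assumes ab: "x i < x (Suc i)"
    and p: "is_weak_deriv_on r x v i p" and p': "is_weak_deriv_on r x v i p'"
  shows "p = p'"
proof (rule ccontr)
  assume "p \<noteq> p'"
  define d where "d = p - p'"
  have d0: "d \<noteq> 0" and dd: "degree d \<le> r"
    using \<open>p \<noteq> p'\<close> p p' by (auto simp: d_def is_weak_deriv_on_def intro: degree_diff_le)
  have "integral {x i..x (Suc i)} (\<lambda>t. poly p t * poly d t) =
        integral {x i..x (Suc i)} (\<lambda>t. poly p' t * poly d t)"
    using p p' dd by (simp add: is_weak_deriv_on_def)
  moreover have "integral {x i..x (Suc i)} (\<lambda>t. poly d t * poly d t) =
      integral {x i..x (Suc i)} (\<lambda>t. poly p t * poly d t) -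
      integral {x i..x (Suc i)} (\<lambda>t. poly p' t * poly d t)"
    by (subst Henstock_Kurzweil_Integration.integral_diff[symmetric])
      (simp_all only: poly_mult_integrable, simp add: d_def left_diff_distrib)
  ultimately show False using integral_square_pos[OF ab d0] by simp
qed

lemma is_weak_deriv_on_weak_deriv:
  assumes ab: "x i < x (Suc i)"
  shows "is_weak_deriv_on r x v i (weak_deriv r x v i)"
proof -
  let ?L = "\<lambda>q. - integral {x i..x (Suc i)} (\<lambda>t. poly (interior_part v i) t * poly (pderiv q) t)
          + nodal_value v (Suc i) * poly q (x (Suc i)) - nodal_value v i * poly q (x i)"
  have add: "?L (p + q) = ?L p + ?L q" for p q
    by (simp add: pderiv_add distrib_left integral_add poly_mult_integrable)
  have scale: "?L (smult c p) = c * ?L p" for c p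
    by (simp add: pderiv_smult mult.left_commute[of _ c] algebra_simps)
  obtain p where "degree p \<le> r" "\<And>q. degree q \<le> r \<Longrightarrow>
      integral {x i..x (Suc i)} (\<lambda>t. poly p t * poly q t) = ?L q"
    using poly_riesz_ex[OF ab, of ?L r] add scale by blast
  hence "is_weak_deriv_on r x v i p" by (simp add: is_weak_deriv_on_def)
  thus ?thesis unfolding weak_deriv_def
    using is_weak_deriv_on_unique[OF ab] by (metis theI)
qed

end

theory Submission
  imports Defs
begin

text \<open>One time step is a finite system of quadratic equations for the coordinates of \<open>U\<^sub>n\<close>. Testing
  it with \<open>U\<^sub>n\<close> itself cancels the two convection terms and leaves
  \<open>(1/\<tau>) \<parallel>U\<^sub>n\<^sup>0\<parallel>\<^sup>2 + \<nu> \<parallel>d\<^sub>w U\<^sub>n\<parallel>\<^sup>2\<close> minus a linear term. This quadratic form is positive definite because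
  \<open>r \<ge> 1\<close> lets the weak derivative see every nodal value, so the residual points outwards on the
  boundary of a large cube and hence vanishes somewhere inside. The topological input is Kuhn's
  combinatorial lemma, used instead of Brouwer's theorem because the number of coordinates is not
  the dimension of a type.\<close>

section \<open>The Poincare-Miranda theorem on cubes with a finite index set\<close>

text \<open>Coordinates outside \<open>J\<close> are fixed at 0, so cubes of any finite dimension
  live in the one space \<open>'a \<Rightarrow> real\<close>, even when \<open>'a\<close> is
  infinite, and are still compact there.\<close>

definition coord_box :: "'a set \<Rightarrow> real \<Rightarrow> ('a \<Rightarrow> real) set" where
  "coord_box J R = {c. (\<forall>j\<in>J. \<bar>c j\<bar> \<le> R) \<and> (\<forall>j. j \<notin> J \<longrightarrow> c j = 0)}"

text \<open>Tychonoff's theorem: the cube is a product of compact intervals and singletons.\<close>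

lemma compact_coord_box: "compact (coord_box J R)"
proof -
  have "coord_box J R = PiE UNIV (\<lambda>j. if j \<in> J then {-R..R} else {0})"
  proof (intro equalityI subsetI)
    fix c assume "c \<in> PiE UNIV (\<lambda>j. if j \<in> J then {-R..R} else {0})"
    hence "c j \<in> (if j \<in> J then {-R..R} else {0})" for j by blast
    thus "c \<in> coord_box J R" unfolding coord_box_def
      by (smt (verit) atLeastAtMost_iff mem_Collect_eq singletonD)
  qed (auto simp: coord_box_def abs_le_iff minus_le_iff)
  moreover have "compactin (product_topology (\<lambda>i. euclidean) UNIV)
      (PiE UNIV (\<lambda>j::'a. if j \<in> J then {-R..R} else {0::real}))"
    by (auto simp: compactin_PiE)
  ultimately show ?thesis by (simp add: euclidean_product_topology)
qed

lemma tendsto_fun_iff: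
  fixes f :: "'b \<Rightarrow> 'a \<Rightarrow> 'c::topological_space"
  shows "(f \<longlongrightarrow> l) F \<longleftrightarrow> (\<forall>j. ((\<lambda>x. f x j) \<longlongrightarrow> l j) F)"
proof -
  have "(f \<longlongrightarrow> l) F \<longleftrightarrow> limitin (product_topology (\<lambda>i. euclidean) UNIV) f l F"
    by (simp add: euclidean_product_topology)
  thus ?thesis by (simp add: limitin_componentwise)
qed

text \<open>Discrete form of the Poincare-Miranda theorem. Divide every edge of the cube into
  \<open>p\<close> parts and label the grid points by the signs of \<open>F\<close>. Kuhn's lemma
  yields a cell in which each coordinate has two vertices with different labels, hence with opposite
  weak signs.\<close>

lemma poincare_miranda_grid:
  fixes F :: "'a \<Rightarrow> ('a \<Rightarrow> real) \<Rightarrow> real" and p :: nat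
  assumes J: "finite J" and R: "R > 0" and p: "p > 0"
    and lo: "\<And>j c. j \<in> J \<Longrightarrow> c \<in> coord_box J R \<Longrightarrow> c j = -R \<Longrightarrow> F j c \<le> 0"
    and hi: "\<And>j c. j \<in> J \<Longrightarrow> c \<in> coord_box J R \<Longrightarrow> c j = R \<Longrightarrow> F j c \<ge> 0"
  shows "\<exists>c\<in>coord_box J R. \<forall>j\<in>J. \<exists>d\<in>coord_box J R. \<exists>e\<in>coord_box J R. F j d \<le> 0 \<and> F j e \<ge> 0 \<and>
           (\<forall>i. \<bar>d i - c i\<bar> \<le> 2 * R / p) \<and> (\<forall>i. \<bar>e i - c i\<bar> \<le> 2 * R / p)"
proof -
  define n where "n = card J"
  obtain b where b: "bij_betw b {..<n} J"
    using ex_bij_betw_nat_finite[OF J] by (auto simp: n_def atLeast0LessThan)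
  define g where "g = the_inv_into {..<n} b"
  have g: "g j < n" "b (g j) = j" if "j \<in> J" for j
    using that b unfolding g_def bij_betw_def
    by (metis lessThan_iff order_refl the_inv_into_into, metis f_the_inv_into_f)
  have gb: "b i \<in> J" "g (b i) = i" if "i < n" for i
    using that b unfolding g_def bij_betw_def by (auto intro: the_inv_into_f_f)
  \<comment> \<open>The index 0 is sent to the face \<open>-R\<close> and the index \<open>p\<close>
    to the face \<open>R\<close>, so neighbouring grid points differ by at most
    \<open>2 * R / p\<close> in each coordinate.\<close>
  define pt where "pt q j = (if j \<in> J then -R + 2 * R * real (q (g j)) / real p else 0)"
    for q :: "nat \<Rightarrow> nat" and j
  have pt_box: "pt q \<in> coord_box J R" if "\<forall>i<n. q i \<le> p" for q
  proof -
    have "\<bar>pt q j\<bar> \<le> R" if "j \<in> J" for j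
    proof -
      have "2 * R * real (q (g j)) / real p \<le> 2 * R"
        using \<open>\<forall>i<n. q i \<le> p\<close> g(1)[OF that] p R by (simp add: field_simps)
      moreover have "2 * R * real (q (g j)) / real p \<ge> 0" using R by simp
      ultimately show ?thesis using that by (simp add: pt_def)
    qed
    thus ?thesis by (simp add: coord_box_def pt_def)
  qed
  have pt_close: "\<bar>pt s j - pt q j\<bar> \<le> 2 * R / p"
    if "\<forall>i<n. q i \<le> s i \<and> s i \<le> q i + 1" for q s j
  proof (cases "j \<in> J")
    case True
    have "pt s j - pt q j = 2 * R / p * (real (s (g j)) - real (q (g j)))"
      using True by (simp add: pt_def algebra_simps diff_divide_distrib)
    moreover have "\<bar>real (s (g j)) - real (q (g j))\<bar> \<le> 1"
      using that g(1)[OF True] by (smt (verit) of_nat_1 of_nat_add of_nat_le_iff)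
    ultimately show ?thesis using R by (simp add: abs_mult mult_left_le divide_right_mono)
  qed (use R in \<open>simp add: pt_def\<close>)
  \<comment> \<open>Kuhn's lemma demands label 0 on the lower face and 1 on the upper one. Forcing
    these values does not spoil the meaning of the labels as signs, because \<open>lo\<close> and
    \<open>hi\<close> give matching signs on the faces.\<close>
  define label where "label q i = (if q i = 0 then 0 else if q i = p then 1
      else if F (b i) (pt q) \<le> 0 then 0 else 1::nat)" for q i
  have label0: "F (b i) (pt q) \<le> 0" if "\<forall>i<n. q i \<le> p" "i < n" "label q i = 0" for q i
    using that lo[OF gb(1) pt_box] gb[of i] by (auto simp: label_def pt_def split: if_splits)
  have label1: "F (b i) (pt q) \<ge> 0" if "\<forall>i<n. q i \<le> p" "i < n" "label q i \<noteq> 0" for q i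
    using that hi[OF gb(1) pt_box] gb[of i] p by (auto simp: label_def pt_def split: if_splits)
  obtain q where q: "\<forall>i<n. q i < p"
    and rs: "\<forall>i<n. \<exists>r s. (\<forall>j<n. q j \<le> r j \<and> r j \<le> q j + 1) \<and>
          (\<forall>j<n. q j \<le> s j \<and> s j \<le> q j + 1) \<and> label r i \<noteq> label s i"
    by (rule kuhn_lemma[of p n label]) (use p in \<open>auto simp: label_def\<close>)
  have "\<exists>d\<in>coord_box J R. \<exists>e\<in>coord_box J R. F j d \<le> 0 \<and> F j e \<ge> 0 \<and>
      (\<forall>i. \<bar>d i - pt q i\<bar> \<le> 2 * R / p) \<and> (\<forall>i. \<bar>e i - pt q i\<bar> \<le> 2 * R / p)" if j: "j \<in> J" for j
  proof -
    obtain r s where r: "\<forall>i<n. q i \<le> r i \<and> r i \<le> q i + 1"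
      and s: "\<forall>i<n. q i \<le> s i \<and> s i \<le> q i + 1" and ne: "label r (g j) \<noteq> label s (g j)"
      using rs g(1)[OF j] by blast
    have rp: "\<forall>i<n. r i \<le> p" and sp: "\<forall>i<n. s i \<le> p" using r s q by force+
    show ?thesis
    proof (cases "label r (g j) = 0")
      case True
      hence "F j (pt r) \<le> 0" "F j (pt s) \<ge> 0"
        using label0[OF rp g(1)[OF j]] label1[OF sp g(1)[OF j]] ne g(2)[OF j] by auto
      thus ?thesis using pt_close[OF r] pt_close[OF s] pt_box[OF rp] pt_box[OF sp] by blast
    next
      case False
      hence "label s (g j) = 0" using ne by (auto simp: label_def split: if_splits)
      hence "F j (pt s) \<le> 0" "F j (pt r) \<ge> 0"
        using label1[OF rp g(1)[OF j]] label0[OF sp g(1)[OF j]] False g(2)[OF j] by auto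
      thus ?thesis using pt_close[OF r] pt_close[OF s] pt_box[OF rp] pt_box[OF sp] by blast
    qed
  qed
  moreover have "pt q \<in> coord_box J R" using q by (intro pt_box) (simp add: less_imp_le)
  ultimately show ?thesis by blast
qed

text \<open>Refine the grid and pass to a convergent subsequence of the cells. For each coordinate
  the points of either sign converge to the same limit, where continuity forces both
  inequalities.\<close>

lemma poincare_miranda:
  fixes F :: "'a::countable \<Rightarrow> ('a \<Rightarrow> real) \<Rightarrow> real"
  assumes J: "finite J" and R: "R > 0"
    and cont: "\<And>j. j \<in> J \<Longrightarrow> continuous_on UNIV (F j)"
    and lo: "\<And>j c. j \<in> J \<Longrightarrow> c \<in> coord_box J R \<Longrightarrow> c j = -R \<Longrightarrow> F j c \<le> 0"
    and hi: "\<And>j c. j \<in> J \<Longrightarrow> c \<in> coord_box J R \<Longrightarrow> c j = R \<Longrightarrow> F j c \<ge> 0"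
  shows "\<exists>c\<in>coord_box J R. \<forall>j\<in>J. F j c = 0"
proof -
  have "\<forall>p. \<exists>c\<in>coord_box J R. \<forall>j\<in>J. \<exists>d\<in>coord_box J R. \<exists>e\<in>coord_box J R. F j d \<le> 0 \<and> F j e \<ge> 0 \<and>
           (\<forall>i. \<bar>d i - c i\<bar> \<le> 2 * R / Suc p) \<and> (\<forall>i. \<bar>e i - c i\<bar> \<le> 2 * R / Suc p)"
    by (intro allI poincare_miranda_grid J R zero_less_Suc lo hi)
  then obtain c where cb: "\<And>p. c p \<in> coord_box J R"
    and "\<forall>p. \<forall>j\<in>J. \<exists>d e. F j d \<le> 0 \<and> F j e \<ge> 0 \<and>
           (\<forall>i. \<bar>d i - c p i\<bar> \<le> 2 * R / Suc p) \<and> (\<forall>i. \<bar>e i - c p i\<bar> \<le> 2 * R / Suc p)"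
    by metis
  then obtain d e where de: "\<And>p j. j \<in> J \<Longrightarrow> F j (d p j) \<le> 0 \<and> F j (e p j) \<ge> 0 \<and>
           (\<forall>i. \<bar>d p j i - c p i\<bar> \<le> 2 * R / Suc p) \<and> (\<forall>i. \<bar>e p j i - c p i\<bar> \<le> 2 * R / Suc p)"
    by metis
  \<comment> \<open>Countability of \<open>'a\<close> makes the function space metric, so the
    compact cube is sequentially compact.\<close>
  have "seq_compact (coord_box J R)" using compact_coord_box compact_eq_seq_compact_metric by blast
  then obtain l \<sigma> where l: "l \<in> coord_box J R" and \<sigma>: "strict_mono \<sigma>" and lim: "(c \<circ> \<sigma>) \<longlonglongrightarrow> l"
    using cb unfolding seq_compact_def by blast
  have small: "(\<lambda>m. 2 * R / Suc (\<sigma> m)) \<longlonglongrightarrow> 0"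
  proof -
    have "(\<lambda>p. 2 * R * inverse (real (Suc p))) \<longlonglongrightarrow> 2 * R * 0"
      by (intro tendsto_intros LIMSEQ_inverse_real_of_nat)
    from LIMSEQ_subseq_LIMSEQ[OF this \<sigma>] show ?thesis by (simp add: o_def divide_inverse)
  qed
  have near: "(\<lambda>m. f (\<sigma> m)) \<longlonglongrightarrow> l" if f: "\<And>p i. \<bar>f p i - c p i\<bar> \<le> 2 * R / Suc p" for f
    unfolding tendsto_fun_iff
  proof
    fix i
    have "(\<lambda>m. f (\<sigma> m) i - c (\<sigma> m) i) \<longlonglongrightarrow> 0"
      by (rule Lim_null_comparison[OF _ small]) (use f in simp)
    moreover have "(\<lambda>m. c (\<sigma> m) i) \<longlonglongrightarrow> l i" using lim by (simp add: tendsto_fun_iff)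
    ultimately show "(\<lambda>m. f (\<sigma> m) i) \<longlonglongrightarrow> l i" using tendsto_add by fastforce
  qed
  have Flim: "(\<lambda>m. F j (f m)) \<longlonglongrightarrow> F j l" if "j \<in> J" "f \<longlonglongrightarrow> l" for j f
    using cont[OF that(1)] that(2) 
    by (intro continuous_on_tendsto_compose[of UNIV "F j" f]) auto
  have "F j l = 0" if j: "j \<in> J" for j
  proof (rule antisym)
    show "F j l \<le> 0"
      by (rule LIMSEQ_le_const2[OF Flim[OF j near[of "\<lambda>p. d p j"]]]) (use de[OF j] in auto)
    show "F j l \<ge> 0"
      by (rule LIMSEQ_le_const[OF Flim[OF j near[of "\<lambda>p. e p j"]]]) (use de[OF j] in auto)
  qed
  thus ?thesis using l by blast
qed

text \<open>A zero of \<open>c - P (c - F c)\<close>, where \<open>P\<close> clamps every coordinate to \<open>[-R, R]\<close>, solves the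
  variational inequality for \<open>F\<close> on the cube.\<close>

lemma acute_angle_zero:
  fixes F :: "'a::countable \<Rightarrow> ('a \<Rightarrow> real) \<Rightarrow> real"
  assumes J: "finite J" and R: "R > 0"
    and cont: "\<And>j. j \<in> J \<Longrightarrow> continuous_on UNIV (F j)"
    and acute: "\<And>c j. c \<in> coord_box J R \<Longrightarrow> j \<in> J \<Longrightarrow> \<bar>c j\<bar> = R \<Longrightarrow> (\<Sum>j\<in>J. c j * F j c) > 0"
  shows "\<exists>c. \<forall>j\<in>J. F j c = 0"
proof -
  \<comment> \<open>The clamped value lies in \<open>[-R, R]\<close>, so \<open>G\<close> has the
    signs required on the faces whatever \<open>F\<close> does there.\<close>
  define G where "G j c = c j - max (-R) (min R (c j - F j c))" for j c
  have "\<exists>c\<in>coord_box J R. \<forall>j\<in>J. G j c = 0"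
  proof (rule poincare_miranda[OF J R])
    show "continuous_on UNIV (G j)" if "j \<in> J" for j
      unfolding G_def by (intro continuous_intros cont that continuous_on_product_coordinates)
  qed (use R in \<open>auto simp: G_def\<close>)
  then obtain c where c: "c \<in> coord_box J R" and G: "\<And>j. j \<in> J \<Longrightarrow> G j c = 0" by blast
  have abs: "\<bar>c j\<bar> \<le> R" if "j \<in> J" for j using c that by (auto simp: coord_box_def)
  have "c j * F j c \<le> 0" if j: "j \<in> J" for j
  proof -
    \<comment> \<open>Either the clamp is active at one end, which fixes the sign of
      \<open>F j c\<close>, or it is inactive and \<open>F j c\<close> vanishes.\<close>
    consider "c j = R" "F j c \<le> 0" | "c j = -R" "F j c \<ge> 0" | "F j c = 0"
      using G[OF j] R by (fastforce simp: G_def max_def min_def split: if_splits)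
    thus ?thesis using R by cases (auto simp: mult_le_0_iff)
  qed
  hence "(\<Sum>j\<in>J. c j * F j c) \<le> 0" by (rule sum_nonpos)
  \<comment> \<open>The sum just bounded contradicts \<open>acute\<close> on the boundary. Hence the
    zero of \<open>G\<close> is interior, the clamp is inactive, and the zero is one of
    \<open>F\<close>.\<close>
  hence "\<bar>c j\<bar> \<noteq> R" if "j \<in> J" for j using acute[OF c that] by force
  hence "F j c = 0" if "j \<in> J" for j
    using G[OF that] abs[OF that] that by (fastforce simp: G_def max_def min_def split: if_splits)
  thus ?thesis by blast
qed

section \<open>Quadratic Galerkin systems in coordinates\<close>

definition unit_coord :: "'a \<Rightarrow> 'a \<Rightarrow> real" where
  "unit_coord j = (\<lambda>i. if i = j then 1 else 0)"

text \<open>For finite \<open>J\<close> this says that \<open>f\<close> is linear and sees only the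
  coordinates in \<open>J\<close>. The expanded form gives continuity at once and reduces testing
  with all vectors to testing with unit vectors.\<close>

definition coord_linear :: "'a set \<Rightarrow> (('a \<Rightarrow> real) \<Rightarrow> real) \<Rightarrow> bool" where
  "coord_linear J f \<longleftrightarrow> (\<forall>c. f c = (\<Sum>j\<in>J. c j * f (unit_coord j)))"

lemma coord_linearD: "coord_linear J f \<Longrightarrow> f c = (\<Sum>j\<in>J. c j * f (unit_coord j))"
  unfolding coord_linear_def by blast

lemma coord_linear_scale: "coord_linear J f \<Longrightarrow> f (\<lambda>j. s * c j) = s * f c"
  using coord_linearD[of J f c] coord_linearD[of J f "\<lambda>j. s * c j"]
  by (simp add: sum_distrib_left mult.assoc)

text \<open>\<open>c\<close> itself need not be a finite combination of unit vectors, but it agrees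
  with one on \<open>J\<close>, and \<open>cong\<close> allows the exchange.\<close>

lemma coord_linearI:
  assumes J: "finite J"
    and add: "\<And>c d. f (\<lambda>j. c j + d j) = f c + f d"
    and scale: "\<And>s c. f (\<lambda>j. s * c j) = s * f c"
    and cong: "\<And>c d. (\<And>j. j \<in> J \<Longrightarrow> c j = d j) \<Longrightarrow> f c = f d"
  shows "coord_linear J f"
  unfolding coord_linear_def
proof
  fix c
  have "f (\<lambda>i. \<Sum>j\<in>A. c j * unit_coord j i) = (\<Sum>j\<in>A. c j * f (unit_coord j))"
    if "finite A" for A
    using that
  proof (induction A)
    case empty
    thus ?case using scale[of 0 "\<lambda>_. 0"] by simp
  next
    case (insert k A)
    thus ?case using add[of "\<lambda>i. c k * unit_coord k i"] by (simp add: scale)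
  qed
  moreover have "f c = f (\<lambda>i. \<Sum>j\<in>J. c j * unit_coord j i)"
    using J by (intro cong) (simp add: unit_coord_def if_distrib[of "(*) _"] cong: if_cong)
  ultimately show "f c = (\<Sum>j\<in>J. c j * f (unit_coord j))" using J by simp
qed

lemma continuous_on_coord_linear:
  assumes "coord_linear J f"
  shows "continuous_on UNIV f"
proof -
  have "f = (\<lambda>c. \<Sum>j\<in>J. c j * f (unit_coord j))"
    using assms unfolding coord_linear_def by blast
  thus ?thesis
    by (rule ssubst) (intro continuous_intros continuous_on_product_coordinates)
qed

lemma continuous_on_bilinear_diag:
  assumes "\<And>d. coord_linear J (\<lambda>c. a c d)" "\<And>c. coord_linear J (a c)"
  shows "continuous_on UNIV (\<lambda>c. a c c)"
proof -
  have "a c c = (\<Sum>i\<in>J. \<Sum>j\<in>J. c i * c j * a (unit_coord i) (unit_coord j))" for c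
    using coord_linearD[OF assms(1), of c c] coord_linearD[OF assms(2), of _ c]
    by (simp add: sum_distrib_left mult.assoc)
  hence "(\<lambda>c. a c c) = (\<lambda>c. \<Sum>i\<in>J. \<Sum>j\<in>J. c i * c j * a (unit_coord i) (unit_coord j))" ..
  thus ?thesis
    by (rule ssubst) (intro continuous_intros continuous_on_product_coordinates)
qed

text \<open>A positive quadratic form attains a positive minimum on the compact unit sphere of the
  maximum norm, and homogeneity carries the bound to radius \<open>R\<close>.\<close>

lemma quadratic_coercive:
  fixes a :: "('a::countable \<Rightarrow> real) \<Rightarrow> ('a \<Rightarrow> real) \<Rightarrow> real"
  assumes J: "finite J" and left: "\<And>d. coord_linear J (\<lambda>c. a c d)"
    and right: "\<And>c. coord_linear J (a c)"
    and pos: "\<And>c j. j \<in> J \<Longrightarrow> c j \<noteq> 0 \<Longrightarrow> a c c > 0"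
  shows "\<exists>m>0. \<forall>R>0. \<forall>c\<in>coord_box J R. \<forall>j\<in>J. \<bar>c j\<bar> = R \<longrightarrow> a c c \<ge> m * R^2"
proof (cases "J = {}")
  case False
  \<comment> \<open>The unit sphere of the maximum norm, written as the union of its faces.\<close>
  define K where "K = coord_box J 1 \<inter> (\<Union>j\<in>J. {c. \<bar>c j\<bar> = 1})"
  have "closed (\<Union>j\<in>J. {c :: 'a \<Rightarrow> real. \<bar>c j\<bar> = 1})"
    using J by (intro closed_UN ballI closed_Collect_eq continuous_intros
        continuous_on_product_coordinates) auto
  hence K: "compact K" unfolding K_def by (intro compact_Int_closed compact_coord_box)
  from False obtain j where j: "j \<in> J" by blast
  hence "unit_coord j \<in> K" by (auto simp: K_def coord_box_def unit_coord_def)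
  hence "K \<noteq> {}" by blast
  moreover have "continuous_on K (\<lambda>c. a c c)"
    using continuous_on_bilinear_diag[OF left right] by (rule continuous_on_subset) simp
  ultimately obtain c0 where c0: "c0 \<in> K" and min: "\<And>c. c \<in> K \<Longrightarrow> a c0 c0 \<le> a c c"
    using continuous_attains_inf[OF K] by blast
  have "a c0 c0 > 0" using c0 pos by (fastforce simp: K_def)
  moreover have "a c c \<ge> a c0 c0 * R^2"
    if "R > 0" "c \<in> coord_box J R" "j \<in> J" "\<bar>c j\<bar> = R" for R c j
  proof -
    let ?d = "\<lambda>j. inverse R * c j"
    have "?d \<in> K" using that by (auto simp: K_def coord_box_def abs_mult field_simps)
    hence "a c0 c0 \<le> a ?d ?d" by (rule min)
    also have "a ?d ?d = inverse R * (inverse R * a c c)"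
      using coord_linear_scale[OF left, of "inverse R" c ?d]
        coord_linear_scale[OF right, of c "inverse R" c] by simp
    finally show ?thesis using \<open>R > 0\<close> by (simp add: field_simps power2_eq_square)
  qed
  ultimately show ?thesis by blast
qed (auto intro: exI[of _ 1])

text \<open>In the application \<open>a\<close> holds mass and diffusion, \<open>b\<close> the
  convection terms and \<open>l\<close> the previous time level. Since \<open>b c c c = 0\<close>,
  pairing the residual with \<open>c\<close> leaves \<open>a c c - l c\<close>, whose quadratic part
  dominates on a large cube.\<close>

lemma galerkin_solvable:
  fixes a :: "('a::countable \<Rightarrow> real) \<Rightarrow> ('a \<Rightarrow> real) \<Rightarrow> real"
  assumes J: "finite J" and left: "\<And>d. coord_linear J (\<lambda>c. a c d)"
    and right: "\<And>c. coord_linear J (a c)"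
    and pos: "\<And>c j. j \<in> J \<Longrightarrow> c j \<noteq> 0 \<Longrightarrow> a c c > 0"
    and l: "coord_linear J l"
    and b1: "\<And>d e. coord_linear J (\<lambda>c. b c d e)" and b2: "\<And>c e. coord_linear J (\<lambda>d. b c d e)"
    and b3: "\<And>c d. coord_linear J (b c d)" and b0: "\<And>c. b c c c = 0"
  shows "\<exists>c. \<forall>d. a c d + b c c d = l d"
proof -
  define F where "F j c = a c (unit_coord j) + b c c (unit_coord j) - l (unit_coord j)" for j c
  have expand: "(\<Sum>j\<in>J. d j * F j c) = a c d + b c c d - l d" for c d
    unfolding F_def coord_linearD[OF right, of c d] coord_linearD[OF b3, of c c d]
      coord_linearD[OF l, of d]
    by (simp add: algebra_simps sum.distrib sum_subtractf)
  have "\<exists>m>0. \<forall>R>0. \<forall>c\<in>coord_box J R. \<forall>j\<in>J. \<bar>c j\<bar> = R \<longrightarrow> a c c \<ge> m * R^2"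
    by (intro quadratic_coercive J left right pos)
  then obtain m where m: "m > 0" and coer: "\<And>R c j. R > 0 \<Longrightarrow> c \<in> coord_box J R \<Longrightarrow>
      j \<in> J \<Longrightarrow> \<bar>c j\<bar> = R \<Longrightarrow> a c c \<ge> m * R^2"
    by blast
  define L where "L = (\<Sum>j\<in>J. \<bar>l (unit_coord j)\<bar>)"
  have "L \<ge> 0" unfolding L_def by (intro sum_nonneg) simp
  \<comment> \<open>Chosen so that \<open>m * R = L + m > L\<close>, which makes the coercive bound
    \<open>m * R^2\<close> exceed the bound \<open>R * L\<close> for \<open>l c\<close>.\<close>
  define R where "R = L / m + 1"
  have R: "R > 0" using \<open>L \<ge> 0\<close> m by (simp add: R_def add_nonneg_pos)
  have "\<exists>c. \<forall>j\<in>J. F j c = 0"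
  proof (rule acute_angle_zero[OF J R])
    fix j assume "j \<in> J"
    have "continuous_on UNIV (\<lambda>c. a c (unit_coord j))"
      by (rule continuous_on_coord_linear[OF left])
    moreover have "continuous_on UNIV (\<lambda>c. b c c (unit_coord j))"
      by (intro continuous_on_bilinear_diag[of J "\<lambda>c d. b c d (unit_coord j)"] b1 b2)
    ultimately show "continuous_on UNIV (F j)"
      unfolding F_def by (intro continuous_intros)
  next
    fix c j assume c: "c \<in> coord_box J R" and j: "j \<in> J" "\<bar>c j\<bar> = R"
    have "l c \<le> (\<Sum>j\<in>J. R * \<bar>l (unit_coord j)\<bar>)"
      unfolding coord_linearD[OF l, of c]
    proof (rule sum_mono)
      fix i assume "i \<in> J"
      hence "\<bar>c i\<bar> * \<bar>l (unit_coord i)\<bar> \<le> R * \<bar>l (unit_coord i)\<bar>"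
        using c by (intro mult_right_mono) (auto simp: coord_box_def)
      thus "c i * l (unit_coord i) \<le> R * \<bar>l (unit_coord i)\<bar>"
        by (metis abs_le_D1 abs_mult)
    qed
    also have "\<dots> = R * L" by (simp add: L_def sum_distrib_left)
    also have "\<dots> < R * (m * R)"
      using R m by (intro mult_strict_left_mono) (simp_all add: R_def distrib_left)
    also have "\<dots> \<le> a c c" using coer[OF R c j] by (simp add: power2_eq_square mult_ac)
    finally show "(\<Sum>j\<in>J. c j * F j c) > 0" by (simp add: expand b0)
  qed
  then obtain c where "\<And>j. j \<in> J \<Longrightarrow> F j c = 0" by blast
  hence "a c d + b c c d - l d = 0" for d using expand[of d c] by simp
  thus ?thesis by (metis eq_iff_diff_eq_0)
qed

lemma coord_linear_cmult: "coord_linear J f \<Longrightarrow> coord_linear J (\<lambda>c. s * f c)"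
  unfolding coord_linear_def
proof
  fix c assume "\<forall>c. f c = (\<Sum>j\<in>J. c j * f (unit_coord j))"
  hence "f c = (\<Sum>j\<in>J. c j * f (unit_coord j))" by blast
  thus "s * f c = (\<Sum>j\<in>J. c j * (s * f (unit_coord j)))"
    by (simp add: sum_distrib_left mult.left_commute)
qed

lemma coord_linear_add:
  "coord_linear J f \<Longrightarrow> coord_linear J h \<Longrightarrow> coord_linear J (\<lambda>c. f c + h c)"
  unfolding coord_linear_def
proof
  fix c assume "\<forall>c. f c = (\<Sum>j\<in>J. c j * f (unit_coord j))"
    "\<forall>c. h c = (\<Sum>j\<in>J. c j * h (unit_coord j))"
  hence "f c = (\<Sum>j\<in>J. c j * f (unit_coord j))" "h c = (\<Sum>j\<in>J. c j * h (unit_coord j))"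
    by blast+
  thus "f c + h c = (\<Sum>j\<in>J. c j * (f (unit_coord j) + h (unit_coord j)))"
    by (simp add: distrib_left sum.distrib)
qed

lemma coord_linear_diff:
  "coord_linear J f \<Longrightarrow> coord_linear J h \<Longrightarrow> coord_linear J (\<lambda>c. f c - h c)"
  using coord_linear_add[of J f "\<lambda>c. (-1) * h c"] coord_linear_cmult[of J h "-1"] by simp

section \<open>The discrete inner product and the weak derivative\<close>

lemma inner_h_cong:
  assumes "\<And>i. i \<in> {1..<N} \<Longrightarrow> p i = p' i" "\<And>i. i \<in> {1..<N} \<Longrightarrow> q i = q' i"
  shows "inner_h N x p q = inner_h N x p' q'"
  unfolding inner_h_def using assms by (intro sum.cong) auto

lemma inner_h_commute: "inner_h N x p q = inner_h N x q p"
  by (simp add: inner_h_def mult.commute)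

lemma inner_h_add_left: "inner_h N x (\<lambda>i. p i + p' i) q = inner_h N x p q + inner_h N x p' q"
  by (simp add: inner_h_def distrib_right integral_add poly_mult_integrable sum.distrib)

lemma inner_h_smult_left: "inner_h N x (\<lambda>i. smult s (p i)) q = s * inner_h N x p q"
  by (simp add: inner_h_def mult.assoc sum_distrib_left)

lemma inner_h_nonneg: "inner_h N x p p \<ge> 0"
  unfolding inner_h_def by (intro sum_nonneg integral_nonneg poly_mult_integrable) auto

lemma inner_h_eq_0D:
  assumes "is_partition N x" "inner_h N x p p = 0" "i \<in> {1..<N}"
  shows "p i = 0"
proof (rule ccontr)
  assume "p i \<noteq> 0"
  hence "integral {x i..x (Suc i)} (\<lambda>t. poly (p i) t * poly (p i) t) > 0"
    using assms by (intro integral_square_pos) (auto simp: is_partition_def)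
  hence "inner_h N x p p > 0"
    unfolding inner_h_def using assms(3)
    by (intro sum_pos2[of _ i] integral_nonneg poly_mult_integrable) auto
  thus False using assms(2) by simp
qed

text \<open>Replaces the description operator by its defining identity; additivity and homogeneity
  below follow by checking that identity.\<close>

lemma weak_deriv_eqI:
  "x i < x (Suc i) \<Longrightarrow> is_weak_deriv_on r x v i p \<Longrightarrow> weak_deriv r x v i = p"
  using is_weak_deriv_on_unique is_weak_deriv_on_weak_deriv by blast

lemma weak_deriv_add:
  assumes "x i < x (Suc i)"
    and "interior_part w i = interior_part u i + interior_part v i"
    and "\<And>i. nodal_value w i = nodal_value u i + nodal_value v i"
  shows "weak_deriv r x w i = weak_deriv r x u i + weak_deriv r x v i"
  using is_weak_deriv_on_weak_deriv[OF assms(1), of r u]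
    is_weak_deriv_on_weak_deriv[OF assms(1), of r v]
  by (intro weak_deriv_eqI assms(1))
    (auto simp: is_weak_deriv_on_def assms(2,3) degree_add_le distrib_right integral_add
      poly_mult_integrable)

lemma weak_deriv_smult:
  assumes "x i < x (Suc i)"
    and "interior_part w i = smult s (interior_part u i)"
    and "\<And>i. nodal_value w i = s * nodal_value u i"
  shows "weak_deriv r x w i = smult s (weak_deriv r x u i)"
  using is_weak_deriv_on_weak_deriv[OF assms(1), of r u]
  by (intro weak_deriv_eqI assms(1))
    (auto simp: is_weak_deriv_on_def assms(2,3) mult.assoc right_diff_distrib distrib_left
      intro: order_trans[OF degree_smult_le])

text \<open>Test with the linear polynomial that vanishes at the left node, which is admissible
  because \<open>r \<ge> 1\<close>. Only the right nodal value times the element length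
  survives.\<close>

lemma weak_deriv_eq_0D:
  assumes "x i < x (Suc i)" "r \<ge> 1" "interior_part v i = 0" "weak_deriv r x v i = 0"
  shows "nodal_value v (Suc i) = 0"
proof -
  have "nodal_value v (Suc i) * (x (Suc i) - x i) = 0"
    using is_weak_deriv_on_weak_deriv[OF assms(1), of r v] assms
    by (auto simp: is_weak_deriv_on_def dest!: spec[of _ "[:- x i, 1:]"])
  thus ?thesis using assms(1) by simp
qed

section \<open>Piecewise polynomials depending linearly on coordinates\<close>

text \<open>Only true elements are constrained: elsewhere the weak derivative may be an unspecified
  value, and \<open>inner_h\<close> does not look there.\<close>

definition coord_linear_pw ::
  "nat \<Rightarrow> 'a set \<Rightarrow> (('a \<Rightarrow> real) \<Rightarrow> nat \<Rightarrow> real poly) \<Rightarrow> bool" where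
  "coord_linear_pw N J P \<longleftrightarrow>
     (\<forall>i\<in>{1..<N}. \<forall>c d. P (\<lambda>j. c j + d j) i = P c i + P d i) \<and>
     (\<forall>i\<in>{1..<N}. \<forall>s c. P (\<lambda>j. s * c j) i = smult s (P c i)) \<and>
     (\<forall>i\<in>{1..<N}. \<forall>c d. (\<forall>j\<in>J. c j = d j) \<longrightarrow> P c i = P d i)"

lemma coord_linear_pw_mult_left: "coord_linear_pw N J P \<Longrightarrow> coord_linear_pw N J (\<lambda>c i. q i * P c i)"
  unfolding coord_linear_pw_def by (auto simp: distrib_left)

lemma coord_linear_pw_mult_right: "coord_linear_pw N J P \<Longrightarrow> coord_linear_pw N J (\<lambda>c i. P c i * q i)"
  using coord_linear_pw_mult_left[of N J P q] by (simp add: mult.commute)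

lemma coord_linear_inner_h_left:
  assumes J: "finite J" and P: "coord_linear_pw N J P"
  shows "coord_linear J (\<lambda>c. inner_h N x (P c) q)"
proof (rule coord_linearI[OF J])
  show "inner_h N x (P (\<lambda>j. c j + d j)) q = inner_h N x (P c) q + inner_h N x (P d) q" for c d
    unfolding inner_h_add_left[symmetric]
    using P by (intro inner_h_cong) (auto simp: coord_linear_pw_def)
  show "inner_h N x (P (\<lambda>j. s * c j)) q = s * inner_h N x (P c) q" for s c
    unfolding inner_h_smult_left[symmetric]
    using P by (intro inner_h_cong) (auto simp: coord_linear_pw_def)
  show "inner_h N x (P c) q = inner_h N x (P d) q" if "\<And>j. j \<in> J \<Longrightarrow> c j = d j" for c d
    using P that unfolding coord_linear_pw_def by (intro inner_h_cong) blast+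
qed

lemma coord_linear_inner_h_right:
  "finite J \<Longrightarrow> coord_linear_pw N J P \<Longrightarrow> coord_linear J (\<lambda>c. inner_h N x q (P c))"
  using coord_linear_inner_h_left[of J N P x q] by (simp add: inner_h_commute)

section \<open>Coordinates on the space of weak functions\<close>

text \<open>The coordinate \<open>(i, j)\<close> with \<open>j \<le> k\<close> is the coefficient of degree \<open>j\<close> on element \<open>i\<close>; the
  coordinate \<open>(i, Suc k)\<close> is the value at the interior node \<open>i\<close>.\<close>

definition coord_index :: "nat \<Rightarrow> nat \<Rightarrow> (nat \<times> nat) set" where
  "coord_index N k = {1..<N} \<times> {..k} \<union> {2..<N} \<times> {Suc k}"

definition from_coords :: "nat \<Rightarrow> nat \<Rightarrow> (nat \<times> nat \<Rightarrow> real) \<Rightarrow> weak_function" where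
  "from_coords N k c =
     \<lparr>interior_part = (\<lambda>i. if i \<in> {1..<N} then \<Sum>j\<le>k. monom (c (i, j)) j else 0),
      nodal_value = (\<lambda>i. if i \<in> {2..<N} then c (i, Suc k) else 0)\<rparr>"

lemma from_coords_in_weak_space0: "from_coords N k c \<in> weak_space0 N k"
  by (auto simp: weak_space0_def weak_space_def from_coords_def
      intro!: degree_sum_le order_trans[OF degree_monom_le])

lemma weak_space0_from_coordsE:
  assumes "v \<in> weak_space0 N k"
  obtains c where "v = from_coords N k c"
proof
  define c where "c = (\<lambda>(i, j). if j \<le> k then coeff (interior_part v i) j else nodal_value v i)"
  have "interior_part (from_coords N k c) i = interior_part v i" for i
  proof (cases "i \<in> {1..<N}")
    case True
    hence "degree (interior_part v i) \<le> k"
      using assms by (simp add: weak_space0_def weak_space_def)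
    thus ?thesis using True poly_as_sum_of_monoms'[of "interior_part v i" k]
      by (simp add: from_coords_def c_def)
  next
    case False
    thus ?thesis using assms by (auto simp: from_coords_def weak_space0_def weak_space_def)
  qed
  moreover have "nodal_value (from_coords N k c) i = nodal_value v i" for i
  proof (cases "i \<in> {2..<N}")
    case False
    \<comment> \<open>At the two boundary nodes the value is 0 by the boundary condition, elsewhere
      by the convention for indices that belong to no node.\<close>
    hence "i = 1 \<or> i = N \<or> i \<notin> {1..N}" by auto
    thus ?thesis using False assms
      by (auto simp: from_coords_def weak_space0_def weak_space_def)
  qed (simp add: from_coords_def c_def)
  ultimately show "v = from_coords N k c"
    by (intro weak_function.equality) auto
qed

lemma finite_coord_index: "finite (coord_index N k)"
  by (simp add: coord_index_def)

lemma from_coords_cong: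
  "(\<And>j. j \<in> coord_index N k \<Longrightarrow> c j = d j) \<Longrightarrow> from_coords N k c = from_coords N k d"
  by (auto simp: from_coords_def coord_index_def fun_eq_iff)

lemma from_coords_add:
  "interior_part (from_coords N k (\<lambda>j. c j + d j)) i =
     interior_part (from_coords N k c) i + interior_part (from_coords N k d) i"
  "nodal_value (from_coords N k (\<lambda>j. c j + d j)) i =
     nodal_value (from_coords N k c) i + nodal_value (from_coords N k d) i"
  by (simp_all add: from_coords_def add_monom[symmetric] sum.distrib)

lemma from_coords_smult:
  "interior_part (from_coords N k (\<lambda>j. s * c j)) i = smult s (interior_part (from_coords N k c) i)"
  "nodal_value (from_coords N k (\<lambda>j. s * c j)) i = s * nodal_value (from_coords N k c) i"
  by (simp_all add: from_coords_def poly_eq_iff coeff_sum sum_distrib_left if_distrib cong: if_cong)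

lemma coord_linear_pw_interior_part:
  "coord_linear_pw N (coord_index N k) (\<lambda>c. interior_part (from_coords N k c))"
  unfolding coord_linear_pw_def
  by (auto simp: from_coords_add from_coords_smult cong: from_coords_cong)

lemma coord_linear_pw_weak_deriv:
  assumes "is_partition N x"
  shows "coord_linear_pw N (coord_index N k) (\<lambda>c. weak_deriv r x (from_coords N k c))"
  unfolding coord_linear_pw_def using assms
  by (auto simp: is_partition_def from_coords_add from_coords_smult
      intro!: weak_deriv_add weak_deriv_smult arg_cong[of _ _ "\<lambda>u. weak_deriv r x u _"]
        from_coords_cong)

text \<open>If both squares vanish, so do the interior part and the weak derivative on every
  element. The first kills all polynomial coefficients, and then \<open>weak_deriv_eq_0D\<close>
  kills the interior nodal values.\<close>

lemma from_coords_energy_pos: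
  assumes "is_partition N x" "r \<ge> 1" "\<alpha> > 0" "\<nu> > 0"
    and j: "j \<in> coord_index N k" "c j \<noteq> 0"
  defines "u \<equiv> from_coords N k c"
  shows "\<alpha> * inner_h N x (interior_part u) (interior_part u)
    + \<nu> * inner_h N x (weak_deriv r x u) (weak_deriv r x u) > 0" (is "?a + ?b > 0")
proof (rule ccontr)
  assume "\<not> ?thesis"
  moreover have "?a \<ge> 0" "?b \<ge> 0" using assms(3,4) by (simp_all add: inner_h_nonneg)
  ultimately have "?a = 0" "?b = 0" by linarith+
  hence u0: "interior_part u i = 0" and du0: "weak_deriv r x u i = 0" if "i \<in> {1..<N}" for i
    using assms(3,4) inner_h_eq_0D[OF assms(1) _ that] by auto
  obtain i m where im: "j = (i, m)" by fastforce
  show False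
  proof (cases "m \<le> k")
    case True
    hence i: "i \<in> {1..<N}" using j(1) im by (auto simp: coord_index_def)
    have "c (i, m) = coeff (interior_part u i) m"
      using True i by (simp add: u_def from_coords_def coeff_sum)
    thus False using u0[OF i] j(2) im by simp
  next
    case False
    hence i: "i \<in> {2..<N}" and m: "m = Suc k" using j(1) im by (auto simp: coord_index_def)
    \<comment> \<open>An interior node \<open>i\<close> is the right end of element
      \<open>i - 1\<close>, which exists because \<open>i \<ge> 2\<close>.\<close>
    then obtain i' where i': "i = Suc i'" "i' \<in> {1..<N}" by (cases i) auto
    have "nodal_value u (Suc i') = 0"
      using i' assms(1,2) by (intro weak_deriv_eq_0D[of x i' r] u0 du0) (auto simp: is_partition_def)
    thus False using i i' m im j(2) by (simp add: u_def from_coords_def)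
  qed
qed

section \<open>One implicit Euler step and the iteration in time\<close>

lemma implicit_Euler_step_solvable:
  assumes part: "is_partition N x" and r: "r \<ge> 1" and \<nu>: "\<nu> > 0" and \<tau>: "\<tau> > 0"
  shows "\<exists>u\<in>weak_space0 N k. \<forall>v\<in>weak_space0 N k.
    inner_h N x (interior_part (diff_quot \<tau> u w)) (interior_part v)
        + \<nu> * inner_h N x (weak_deriv r x u) (weak_deriv r x v)
        + 1 / 3 * inner_h N x (\<lambda>i. interior_part u i * weak_deriv r x u i) (interior_part v)
        - 1 / 3 * inner_h N x (\<lambda>i. interior_part u i * interior_part u i) (weak_deriv r x v)
        = 0"
proof -
  let ?u = "\<lambda>c. interior_part (from_coords N k c)"
  let ?du = "\<lambda>c. weak_deriv r x (from_coords N k c)"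
  \<comment> \<open>The difference quotient is split: its new half joins the diffusion in
    \<open>a\<close>, its old half becomes the right-hand side \<open>l\<close>. The convection
    terms are made trilinear by separating the two occurrences of the unknown.\<close>
  define a where "a c d = 1 / \<tau> * inner_h N x (?u c) (?u d) + \<nu> * inner_h N x (?du c) (?du d)" for c d
  define l where "l d = 1 / \<tau> * inner_h N x (interior_part w) (?u d)" for d
  define b where "b c d e = 1 / 3 * inner_h N x (\<lambda>i. ?u c i * ?du d i) (?u e)
      - 1 / 3 * inner_h N x (\<lambda>i. ?u c i * ?u d i) (?du e)" for c d e
  note lin = coord_linear_add coord_linear_diff coord_linear_cmult
    coord_linear_inner_h_left[OF finite_coord_index]
    coord_linear_inner_h_right[OF finite_coord_index]
  note pw = coord_linear_pw_interior_part coord_linear_pw_weak_deriv[OF part]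
  have "\<exists>c. \<forall>d. a c d + b c c d = l d"
  proof (rule galerkin_solvable[where b = b, OF finite_coord_index])
    show "coord_linear (coord_index N k) (\<lambda>c. a c d)" for d
      unfolding a_def by (intro lin pw)
    show "coord_linear (coord_index N k) (a c)" for c
      unfolding a_def by (intro lin pw)
    show "coord_linear (coord_index N k) l"
      unfolding l_def by (intro lin pw)
    show "coord_linear (coord_index N k) (\<lambda>c. b c d e)" for d e
      unfolding b_def by (intro lin coord_linear_pw_mult_right pw)
    show "coord_linear (coord_index N k) (\<lambda>d. b c d e)" for c e
      unfolding b_def by (intro lin coord_linear_pw_mult_left pw)
    show "coord_linear (coord_index N k) (b c d)" for c d
      unfolding b_def by (intro lin pw)
    show "a c c > 0" if "j \<in> coord_index N k" "c j \<noteq> 0" for c j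
      unfolding a_def by (intro from_coords_energy_pos[where j = j] part r \<nu> that) (simp add: \<tau>)
    \<comment> \<open>With all arguments equal, both terms are one third of the integral of the
      squared interior part times the weak derivative.\<close>
    show "b c c c = 0" for c by (simp add: b_def inner_h_def mult_ac)
  qed
  then obtain c where c: "\<And>d. a c d + b c c d = l d" by blast
  have dq: "inner_h N x (interior_part (diff_quot \<tau> (from_coords N k c) w)) q
      = 1 / \<tau> * inner_h N x (?u c) q - 1 / \<tau> * inner_h N x (interior_part w) q" for q
  proof -
    have "inner_h N x (interior_part (diff_quot \<tau> (from_coords N k c) w)) q
      = inner_h N x (\<lambda>i. smult (1 / \<tau>) (?u c i) + smult (- 1 / \<tau>) (interior_part w i)) q"
      by (intro inner_h_cong) (simp_all add: diff_quot_def smult_diff_right)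
    thus ?thesis by (simp only: inner_h_add_left inner_h_smult_left)
  qed
  have eq: "inner_h N x (interior_part (diff_quot \<tau> (from_coords N k c) w)) (?u d)
        + \<nu> * inner_h N x (?du c) (?du d)
        + 1 / 3 * inner_h N x (\<lambda>i. ?u c i * ?du c i) (?u d)
        - 1 / 3 * inner_h N x (\<lambda>i. ?u c i * ?u c i) (?du d) = 0" for d
    using c[of d] dq[of "?u d"] unfolding a_def b_def l_def by linarith
  show ?thesis
  proof (intro bexI ballI)
    fix v assume "v \<in> weak_space0 N k"
    then obtain d where v: "v = from_coords N k d" by (rule weak_space0_from_coordsE)
    show "inner_h N x (interior_part (diff_quot \<tau> (from_coords N k c) w)) (interior_part v)
        + \<nu> * inner_h N x (?du c) (weak_deriv r x v)
        + 1 / 3 * inner_h N x (\<lambda>i. ?u c i * ?du c i) (interior_part v)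
        - 1 / 3 * inner_h N x (\<lambda>i. ?u c i * ?u c i) (weak_deriv r x v) = 0"
      unfolding v by (rule eq)
  qed (rule from_coords_in_weak_space0)
qed

theorem lemma3:
  fixes k r M N :: nat and \<nu> T \<tau> :: real and x :: "nat \<Rightarrow> real" and g :: weak_function
  assumes "r = k + 1" and "\<nu> > 0" and "T > 0" and "M > 0" and "\<tau> = T / real M"
    and "is_partition N x" and "g \<in> weak_space0 N k"
  shows "\<exists>U :: nat \<Rightarrow> weak_function. U 0 = g \<and>
    (\<forall>n\<in>{1..M}. U n \<in> weak_space0 N k \<and>
      (\<forall>v\<in>weak_space0 N k.
        inner_h N x (interior_part (diff_quot \<tau> (U n) (U (n - 1)))) (interior_part v)
        + \<nu> * inner_h N x (weak_deriv r x (U n)) (weak_deriv r x v)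
        + 1 / 3 * inner_h N x (\<lambda>i. interior_part (U n) i * weak_deriv r x (U n) i) (interior_part v)
        - 1 / 3 * inner_h N x (\<lambda>i. interior_part (U n) i * interior_part (U n) i) (weak_deriv r x v)
        = 0))"
proof -
  have "r \<ge> 1" "\<tau> > 0" using assms by simp_all
  define solves where "solves u w \<longleftrightarrow> u \<in> weak_space0 N k \<and> (\<forall>v\<in>weak_space0 N k.
        inner_h N x (interior_part (diff_quot \<tau> u w)) (interior_part v)
        + \<nu> * inner_h N x (weak_deriv r x u) (weak_deriv r x v)
        + 1 / 3 * inner_h N x (\<lambda>i. interior_part u i * weak_deriv r x u i) (interior_part v)
        - 1 / 3 * inner_h N x (\<lambda>i. interior_part u i * interior_part u i) (weak_deriv r x v)
        = 0)" for u w
  have "\<exists>u. solves u w" for w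
    using implicit_Euler_step_solvable[OF assms(6) \<open>r \<ge> 1\<close> assms(2) \<open>\<tau> > 0\<close>, of k w]
    by (simp add: solves_def Bex_def)
  \<comment> \<open>Solvability holds for every previous level \<open>w\<close>, so one choice
    function can be iterated from \<open>g\<close> to produce all time levels.\<close>
  then obtain f where f: "\<And>w. solves (f w) w" by metis
  define U where "U n = (f ^^ n) g" for n
  have "solves (U n) (U (n - 1))" if "n \<in> {1..M}" for n
    using that f by (cases n) (auto simp: U_def)
  moreover have "U 0 = g" by (simp add: U_def)
  ultimately show ?thesis unfolding solves_def by blast
qed

end
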